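(* Let $\alpha\in(0,1)$. Fix an arbitrary step size sequence $\{\gamma_k>0: k=1,2,\ldots\}$ and an initial value $\theta^{(0)}$. Suppose the following two assumptions hold. (1) For each $\omega\in(0,\pi)$ the function $\theta\mapsto S_\theta(\omega)$ is twice continuously differentiable on $\mathrm{int}(\Theta)$; moreover $$\sup_{\theta\in\mathrm{int}(\Theta),\,\omega\in[-\pi,\pi]}\max\Big\{\|\nabla_\theta S_\theta(\omega)\|,\ \|\nabla_\theta\log S_\theta(\omega)\|,\ \big\|\tfrac{1}{S_\theta(\omega)}\nabla_\theta\log S_\theta(\omega)\big\|\Big\}=:U_1<\infty$$ and $$\limsup_{n\to\infty}\left(\sup_{\theta\in\mathrm{int}(\Theta)}\frac1n\sum_{\omega\in\Omega_n}\|\nabla_\theta^2\log S_\theta(\omega)\|_{\mathrm{op}}\right)=:U_2<\infty.$$ (2) For any $z\ge0$, $\omega^*\in\Omega_n$ and $m\in\mathbb{N}$, the $m$-th gradient descent update $\hat\theta^{(m)}_\alpha[\tilde I_n^{z,\omega^*}]$ lies in $\mathrm{int}(\Theta)$. Then for any $m\in\mathbb{N}$, $$\lim_{n\to\infty}\ \sup_{z\ge0,\ \omega^*\in\Omega_n}\Big\|\hat\theta^{(m)}_\alpha[\tilde I_n^{z,\omega^*}]-\hat\theta^{(m)}_\alpha[\tilde I_n]\Big\|=0\quad\text{almost surely.}$$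
   Context: $\mathcal{S}$ is the set of functions $S:[-\pi,\pi]\to[0,\infty]$ such that $\int_{-\pi}^{\pi}S(\omega)\,d\omega<\infty$, and $S(\omega)>0$ and $S(\omega)=S(-\omega)$ for all $\omega\in(0,\pi)$. $\{S_\theta\in\mathcal{S}:\theta\in\Theta\}$ is a parametric spectral model, where $\Theta\subset\mathbb{R}^d$ is compact with nonempty interior $\mathrm{int}(\Theta)$. $\|\cdot\|$ is the Euclidean norm and $\|\cdot\|_{\mathrm{op}}$ the operator norm. $\Omega_n=\{2\pi t/n: t=-\lceil n/2\rceil+1,\ldots,-1,0,1,\ldots,\lfloor n/2\rfloor\}$. For each $n$, $\tilde I_n$ is a (random) nonnegative nonparametric pilot estimate of the spectral density based on observations $x_1,\ldots,x_n$ of a time series, such as the periodogram $I_n(\omega)=\frac{1}{2\pi n}\left|\sum_{t=1}^n x_te^{-\sqrt{-1}t\omega}\right|^2$ or its smoothed versions. For $\omega^*\in\Omega_n$ and $z\ge0$ the contaminated pilot estimate is $$\tilde I_n^{z,\omega^*}(\omega)=\begin{cases}\tilde I_n(\omega)+z,&\omega=\pm\omega^*,\\ \tilde I_n(\omega),&\omega\neq\pm\omega^*.\end{cases}$$ The discrete spectral $\alpha$-Rényi divergence is $$D^{(n)}_{\alpha}[\,S:\tilde S\,]=\frac{1}{(1-\alpha)n}\sum_{\omega\in\Omega_n}\Big[\log\{\alpha\tilde S(\omega)+(1-\alpha)S(\omega)\}-\alpha\log\tilde S(\omega)-(1-\alpha)\log S(\omega)\Big].$$ For a pilot estimate $J$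 ($J=\tilde I_n$ or $J=\tilde I_n^{z,\omega^*}$), the gradient descent updates for $\theta\mapsto D^{(n)}_\alpha[J:S_\theta]$ start at the common initial value $\hat\theta^{(0)}_\alpha[J]=\theta^{(0)}$ and are given by $$\hat\theta^{(m+1)}_\alpha[J]=\hat\theta^{(m)}_\alpha[J]+\gamma_{m+1}\,\mathcal{G}_\alpha(\hat\theta^{(m)}_\alpha[J];J),\qquad m=0,1,2,\ldots,$$ where $$\mathcal{G}_\alpha(\theta;J)=-\nabla_\theta D^{(n)}_\alpha[J:S_\theta]=\frac{\alpha}{(1-\alpha)n}\sum_{\omega\in\Omega_n}\left[1-\frac{S_\theta(\omega)}{\alpha S_\theta(\omega)+(1-\alpha)J(\omega)}\right]\nabla_\theta\log S_\theta(\omega).$$ *)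

theory Defs
  imports "HOL-Probability.Probability"
begin

text \<open>
  Spectral densities are extended nonnegative functions on \<open>[-\<pi>, \<pi>]\<close>; values outside that interval
  are irrelevant. They are real-valued (via \<^const>\<open>enn2real\<close>) wherever they are differentiated.
\<close>

definition spectral_class :: "(real \<Rightarrow> ennreal) set" where
  "spectral_class =
    {S. S \<in> borel_measurable (lebesgue_on {-pi..pi}) \<and>
        (\<integral>\<^sup>+\<omega>. S \<omega> \<partial>lebesgue_on {-pi..pi}) < \<infinity> \<and>
        (\<forall>\<omega>\<in>{0<..<pi}. 0 < S \<omega> \<and> S \<omega> = S (-\<omega>))}"

definition Omega :: "nat \<Rightarrow> real set" where
  "Omega n = (\<lambda>t::int. 2 * pi * of_int t / real n) ` {- \<lceil>real n / 2\<rceil> + 1 .. \<lfloor>real n / 2\<rfloor>}"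


text \<open>
  Gradient and Hessian as total operators. They are unspecified where the derivative does not exist,
  so every use has to be accompanied by a differentiability hypothesis.
\<close>

definition grad :: "(real ^ 'd \<Rightarrow> real) \<Rightarrow> real ^ 'd \<Rightarrow> real ^ 'd" where
  "grad f x = (THE D. GDERIV f x :> D)"

definition hessian :: "(real ^ 'd \<Rightarrow> real) \<Rightarrow> real ^ 'd \<Rightarrow> real ^ 'd ^ 'd" where
  "hessian f x = jacobian (grad f) (at x)"

definition twice_differentiable_on :: "(real ^ 'd \<Rightarrow> real) \<Rightarrow> (real ^ 'd) set \<Rightarrow> bool" where
  "twice_differentiable_on f U \<longleftrightarrow>
    (\<forall>x\<in>U. f differentiable (at x)) \<and> (\<forall>x\<in>U. grad f differentiable (at x))"

definition twice_continuously_differentiable_on ::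
    "(real ^ 'd \<Rightarrow> real) \<Rightarrow> (real ^ 'd) set \<Rightarrow> bool" where
  "twice_continuously_differentiable_on f U \<longleftrightarrow>
    twice_differentiable_on f U \<and> continuous_on U (hessian f)"

definition op_norm :: "real ^ 'd ^ 'd \<Rightarrow> real" where
  "op_norm A = onorm (\<lambda>v. A *v v)"


definition contaminate :: "(real \<Rightarrow> real) \<Rightarrow> real \<Rightarrow> real \<Rightarrow> (real \<Rightarrow> real)" where
  "contaminate J z \<omega>' = (\<lambda>\<omega>. if \<omega> = \<omega>' \<or> \<omega> = - \<omega>' then J \<omega> + z else J \<omega>)"

definition renyi_div :: "real \<Rightarrow> nat \<Rightarrow> (real \<Rightarrow> real) \<Rightarrow> (real \<Rightarrow> real) \<Rightarrow> real" where
  "renyi_div \<alpha> n S T =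
    1 / ((1 - \<alpha>) * real n) *
      (\<Sum>\<omega>\<in>Omega n. ln (\<alpha> * T \<omega> + (1 - \<alpha>) * S \<omega>) - \<alpha> * ln (T \<omega>) - (1 - \<alpha>) * ln (S \<omega>))"

definition descent_dir ::
    "real \<Rightarrow> nat \<Rightarrow> (real ^ 'd \<Rightarrow> real \<Rightarrow> ennreal) \<Rightarrow> (real \<Rightarrow> real) \<Rightarrow> real ^ 'd \<Rightarrow> real ^ 'd" where
  "descent_dir \<alpha> n S J \<theta> =
    (\<alpha> / ((1 - \<alpha>) * real n)) *\<^sub>R
      (\<Sum>\<omega>\<in>Omega n.
        (1 - enn2real (S \<theta> \<omega>) / (\<alpha> * enn2real (S \<theta> \<omega>) + (1 - \<alpha>) * J \<omega>)) *\<^sub>R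
          grad (\<lambda>\<phi>. ln (enn2real (S \<phi> \<omega>))) \<theta>)"

primrec gd_update ::
    "real \<Rightarrow> nat \<Rightarrow> (real ^ 'd \<Rightarrow> real \<Rightarrow> ennreal) \<Rightarrow> (nat \<Rightarrow> real) \<Rightarrow> real ^ 'd \<Rightarrow>
      (real \<Rightarrow> real) \<Rightarrow> nat \<Rightarrow> real ^ 'd" where
  "gd_update \<alpha> n S \<gamma> \<theta>0 J 0 = \<theta>0"
| "gd_update \<alpha> n S \<gamma> \<theta>0 J (Suc m) =
    gd_update \<alpha> n S \<gamma> \<theta>0 J m + \<gamma> (Suc m) *\<^sub>R descent_dir \<alpha> n S J (gd_update \<alpha> n S \<gamma> \<theta>0 J m)"

definition observed :: "(nat \<Rightarrow> 'w \<Rightarrow> real) \<Rightarrow> nat \<Rightarrow> 'w \<Rightarrow> (nat \<Rightarrow> real)" where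
  "observed X n w = (\<lambda>t\<in>{1..n}. X t w)"


lemma grad_eqI:
  assumes "GDERIV f x :> D"
  shows "grad f x = D"
  unfolding grad_def
proof (rule the_equality[where P = "\<lambda>D. GDERIV f x :> D"])
  fix D' assume "GDERIV f x :> D'"
  with assms have "(\<lambda>h. inner h D') = (\<lambda>h. inner h D)"
    unfolding gderiv_def by (rule has_derivative_unique[rotated])
  then have "inner (D' - D) D' = inner (D' - D) D" by (rule fun_cong)
  then have "inner (D' - D) (D' - D) = 0" by (simp add: inner_diff_right)
  then show "D' = D" by simp
qed (fact assms)

lemma GDERIV_grad:
  fixes f :: "real ^ 'd \<Rightarrow> real"
  assumes "f differentiable (at x)"
  shows "GDERIV f x :> grad f x"
proof -
  obtain f' where f': "(f has_derivative f') (at x)"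
    using assms unfolding differentiable_def by blast
  then have "linear f'" by (rule has_derivative_linear)
  then have "f' = (\<lambda>h. inner h (adjoint f' 1))"
    using adjoint_works[of f' _ 1] by auto
  with f' have "GDERIV f x :> adjoint f' 1" unfolding gderiv_def by metis
  then show ?thesis using grad_eqI by metis
qed

lemma GDERIV_sum:
  assumes "\<And>i. i \<in> I \<Longrightarrow> GDERIV (f i) x :> D i"
  shows "GDERIV (\<lambda>y. \<Sum>i\<in>I. f i y) x :> (\<Sum>i\<in>I. D i)"
  using assms unfolding gderiv_def inner_sum_right by (rule has_derivative_sum)

text \<open>
  The explicit formula in \<^const>\<open>descent_dir\<close> is the negative gradient of the divergence. At
  frequencies with \<open>J \<omega> = 0\<close> the term \<open>(1 - \<alpha>) * ln (J \<omega>)\<close> takes the value \<open>0\<close> instead of \<open>-\<infinity>\<close>,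
  which is immaterial because that term does not depend on the parameter.
\<close>

lemma descent_dir_eq_neg_grad:
  fixes S :: "real ^ 'd \<Rightarrow> real \<Rightarrow> ennreal"
  assumes \<alpha>: "0 < \<alpha>" "\<alpha> < 1"
    and J: "\<And>\<omega>. \<omega> \<in> Omega n \<Longrightarrow> 0 \<le> J \<omega>"
    and S: "\<And>\<omega>. \<omega> \<in> Omega n \<Longrightarrow> 0 < S \<theta> \<omega> \<and> S \<theta> \<omega> < \<infinity>"
    and D: "\<And>\<omega>. \<omega> \<in> Omega n \<Longrightarrow> (\<lambda>\<phi>. enn2real (S \<phi> \<omega>)) differentiable (at \<theta>)"
  shows "GDERIV (\<lambda>\<phi>. renyi_div \<alpha> n J (\<lambda>\<omega>. enn2real (S \<phi> \<omega>))) \<theta> :> - descent_dir \<alpha> n S J \<theta>"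
proof -
  define s where "s = (\<lambda>\<omega> \<phi>. enn2real (S \<phi> \<omega>))"
  define G where "G = (\<lambda>\<omega>. grad (\<lambda>\<phi>. ln (s \<omega> \<phi>)) \<theta>)"
  define T where "T = (\<lambda>\<omega> \<phi>. ln (\<alpha> * s \<omega> \<phi> + (1 - \<alpha>) * J \<omega>) - \<alpha> * ln (s \<omega> \<phi>) - (1 - \<alpha>) * ln (J \<omega>))"
  define T' where "T' = (\<lambda>\<omega>. - (\<alpha> * (1 - s \<omega> \<theta> / (\<alpha> * s \<omega> \<theta> + (1 - \<alpha>) * J \<omega>))) *\<^sub>R G \<omega>)"
  have T: "GDERIV (T \<omega>) \<theta> :> T' \<omega>" if \<omega>: "\<omega> \<in> Omega n" for \<omega>
  proof -
    have pos: "0 < s \<omega> \<theta>" using S[OF \<omega>] by (simp add: s_def enn2real_positive_iff)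
    have den: "0 < \<alpha> * s \<omega> \<theta> + (1 - \<alpha>) * J \<omega>"
      using pos \<alpha> J[OF \<omega>] by (simp add: add_pos_nonneg)
    have s: "GDERIV (s \<omega>) \<theta> :> grad (s \<omega>) \<theta>"
      using GDERIV_grad[OF D[OF \<omega>]] by (simp add: s_def)
    have ln: "GDERIV (\<lambda>\<phi>. ln (s \<omega> \<phi>)) \<theta> :> (1 / s \<omega> \<theta>) *\<^sub>R grad (s \<omega>) \<theta>"
      by (rule GDERIV_DERIV_compose[OF s]) (use pos in \<open>auto intro!: derivative_eq_intros\<close>)
    have G: "G \<omega> = (1 / s \<omega> \<theta>) *\<^sub>R grad (s \<omega>) \<theta>"
      unfolding G_def by (rule grad_eqI[OF ln])
    have "((\<lambda>u. ln (\<alpha> * u + (1 - \<alpha>) * J \<omega>) - \<alpha> * ln u - (1 - \<alpha>) * ln (J \<omega>))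
        has_real_derivative (\<alpha> / (\<alpha> * s \<omega> \<theta> + (1 - \<alpha>) * J \<omega>) - \<alpha> / s \<omega> \<theta>)) (at (s \<omega> \<theta>))"
      using pos den by (auto intro!: derivative_eq_intros)
    from GDERIV_DERIV_compose[OF s this]
    have "GDERIV (T \<omega>) \<theta> :>
        (\<alpha> / (\<alpha> * s \<omega> \<theta> + (1 - \<alpha>) * J \<omega>) - \<alpha> / s \<omega> \<theta>) *\<^sub>R grad (s \<omega>) \<theta>"
      unfolding T_def .
    moreover have "\<alpha> / (\<alpha> * s \<omega> \<theta> + (1 - \<alpha>) * J \<omega>) - \<alpha> / s \<omega> \<theta>
        = - (\<alpha> * (1 - s \<omega> \<theta> / (\<alpha> * s \<omega> \<theta> + (1 - \<alpha>) * J \<omega>))) * (1 / s \<omega> \<theta>)"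
    proof -
      have "\<alpha> / d - \<alpha> / x = - (\<alpha> * (1 - x / d)) * (1 / x)" if "0 < x" "0 < d" for x d :: real
        using that by (simp add: field_simps)
      then show ?thesis using pos den by blast
    qed
    ultimately show ?thesis unfolding T'_def G by simp
  qed
  have "GDERIV (\<lambda>\<phi>. 1 / ((1 - \<alpha>) * real n) * (\<Sum>\<omega>\<in>Omega n. T \<omega> \<phi>)) \<theta> :>
      (1 / ((1 - \<alpha>) * real n)) *\<^sub>R (\<Sum>\<omega>\<in>Omega n. T' \<omega>) + (\<Sum>\<omega>\<in>Omega n. T \<omega> \<theta>) *\<^sub>R 0"
    by (intro GDERIV_mult GDERIV_const GDERIV_sum T)
  then show ?thesis
    by (simp add: renyi_div_def descent_dir_def T_def T'_def G_def s_def sum_negf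
        scaleR_right.sum)
qed

end

theory Submission
  imports Defs
begin

text \<open>
  Contaminating one frequency changes at most two of the roughly \<open>n\<close> summands of the descent
  direction, and each of them by a bounded amount, because the weight of a summand lies in
  \<open>[1 - 1/\<alpha>, 1]\<close> whatever the pilot value is. So a single gradient step introduces a discrepancy of
  order \<open>1/n\<close>, uniformly in the size \<open>z\<close> of the contamination, and it remains to see that later steps
  multiply an existing discrepancy by a factor that stays bounded as \<open>n\<close> grows.

  That would follow from a Lipschitz bound for the descent direction, were the parameter set convex.
  It need not be: the interior of \<open>\<Theta>\<close> may even have infinitely many components, and a bounded derivative
  says nothing about two points that are close but lie in different components. What helps is that
  the uncontaminated iterate (\<open>z = 0\<close>) and the contaminated one are joined by the curve that maps
  \<open>z \<ge> 0\<close> to the contaminated iterate, and this curve stays in the interior of \<open>\<Theta>\<close> by hypothesis. The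
  induction over the steps therefore controls the length of the curve instead of the distance of its
  endpoints: if the length is at most \<open>K / n\<close> at one step, then it is at most \<open>K' / n\<close> at the next
  (\<open>length_le_descent_step\<close>), where \<open>K'\<close> depends on \<open>K\<close>, \<open>\<alpha>\<close>, the step size and the bounds on the
  derivatives of the log-densities, but not on \<open>n\<close>, the frequency, or the data.

  The length generated by the contaminated summands has to be bounded uniformly over the infinite
  range of \<open>z\<close>. A contaminated weight depends on \<open>z\<close> in two ways. Through the pilot value it is
  increasing in \<open>z\<close>; through the iterate it varies at a rate controlled by the speed of the curve.
  Hence the absolute rate of change of the weight is at most its signed rate plus a multiple of the speed
  (\<open>weight_along_curve\<close>), and the signed rate integrates to at most the range \<open>1/\<alpha>\<close> of the weight.
\<close>

section \<open>Fourier frequencies\<close>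

lemma finite_Omega: "finite (Omega n)"
  unfolding Omega_def by simp

lemma card_Omega_le: "card (Omega n) \<le> n"
proof -
  have "card (Omega n) \<le> card {- \<lceil>real n / 2\<rceil> + 1 .. \<lfloor>real n / 2\<rfloor>}"
    unfolding Omega_def by (rule card_image_le) simp
  also have "\<dots> = nat (\<lfloor>real n / 2\<rfloor> + \<lceil>real n / 2\<rceil>)"
    by simp
  also have "\<lfloor>real n / 2\<rfloor> + \<lceil>real n / 2\<rceil> \<le> int n"
    by linarith
  finally show ?thesis by linarith
qed

lemma Omega_subset: "Omega n \<subseteq> {-pi..pi}"
proof
  fix \<omega> assume "\<omega> \<in> Omega n"
  then obtain t :: int where t: "\<omega> = 2 * pi * of_int t / real n"
      "- \<lceil>real n / 2\<rceil> + 1 \<le> t" "t \<le> \<lfloor>real n / 2\<rfloor>"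
    unfolding Omega_def by (elim imageE) (auto simp del: add.commute)
  have "\<bar>of_int t\<bar> \<le> real n / 2" using t(2,3) by linarith
  then have "\<bar>2 * of_int t\<bar> \<le> real n" by linarith
  then have "pi * \<bar>2 * of_int t\<bar> \<le> pi * real n"
    by (intro mult_left_mono) auto
  then have "\<bar>\<omega>\<bar> \<le> pi"
    unfolding t(1) by (cases "n = 0") (auto simp: abs_mult field_simps)
  then show "\<omega> \<in> {-pi..pi}" by auto
qed

lemma zero_in_Omega: "1 \<le> n \<Longrightarrow> 0 \<in> Omega n"
  unfolding Omega_def by (rule image_eqI[where x = 0]) auto

section \<open>The weights of the descent direction\<close>

definition weight :: "real \<Rightarrow> real \<Rightarrow> real \<Rightarrow> real" where
  "weight \<alpha> u y = 1 - u / (\<alpha> * u + (1 - \<alpha>) * y)"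

lemma weight_bounds:
  assumes "0 < \<alpha>" "\<alpha> < 1" "0 < u" "0 \<le> y"
  shows "1 - 1 / \<alpha> \<le> weight \<alpha> u y" "weight \<alpha> u y \<le> 1"
proof -
  have "0 < \<alpha> * u" "\<alpha> * u \<le> \<alpha> * u + (1 - \<alpha>) * y" using assms by simp_all
  then have "u / (\<alpha> * u + (1 - \<alpha>) * y) \<le> u / (\<alpha> * u)"
    using assms(3) by (intro frac_le) linarith+
  moreover have "0 \<le> u / (\<alpha> * u + (1 - \<alpha>) * y)" using assms by simp
  moreover have "u / (\<alpha> * u) = 1 / \<alpha>" using assms by simp
  ultimately show "1 - 1 / \<alpha> \<le> weight \<alpha> u y" "weight \<alpha> u y \<le> 1"
    unfolding weight_def by linarith+
qed

lemma abs_weight_le: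
  assumes "0 < \<alpha>" "\<alpha> < 1" "0 < u" "0 \<le> y"
  shows "\<bar>weight \<alpha> u y\<bar> \<le> 1 / \<alpha>"
proof -
  have "1 \<le> 1 / \<alpha>" using assms by simp
  with weight_bounds[OF assms] show ?thesis by linarith
qed

text \<open>
  Write \<open>d\<close> for the denominator of the weight. With \<open>y\<close> and \<open>ln u\<close> as variables, its partial
  derivatives are \<open>(1 - \<alpha>) u / d\<^sup>2 \<ge> 0\<close> and \<open>- (1 - \<alpha>) u y / d\<^sup>2\<close>. The latter is bounded in absolute
  value by \<open>1/\<alpha>\<close>, because \<open>d\<close> is at least each of its two summands. The absolute derivative
  along the curve can thus exceed the signed one only through the motion of \<open>ln u\<close>. The coefficient
  \<open>c\<close> tells whether the pilot value itself moves; if it does not, the motion of \<open>ln u\<close> is the only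
  contribution.
\<close>

lemma weight_along_curve:
  fixes u :: "real \<Rightarrow> real"
  assumes \<alpha>: "0 < \<alpha>" "\<alpha> < 1" and z: "z \<in> T"
    and u: "\<And>x. x \<in> T \<Longrightarrow> 0 < u x"
    and l: "((\<lambda>x. ln (u x)) has_real_derivative l') (at z within T)"
    and y: "0 \<le> y + c * z" and c: "c = 0 \<or> c = 1"
  obtains W' where
    "((\<lambda>x. weight \<alpha> (u x) (y + c * x)) has_real_derivative W') (at z within T)"
    "\<bar>W'\<bar> \<le> c * W' + 2 / \<alpha> * \<bar>l'\<bar>"
proof -
  define Y where "Y = y + c * z"
  define d where "d = \<alpha> * u z + (1 - \<alpha>) * Y"
  define p where "p = c * ((1 - \<alpha>) * u z / d\<^sup>2)"
  define r where "r = (1 - \<alpha>) * u z * Y / d\<^sup>2"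
  have uz: "0 < u z" using u z by blast
  have Y: "0 \<le> Y" using y by (simp add: Y_def)
  have au: "0 < \<alpha> * u z" and ay: "0 \<le> (1 - \<alpha>) * Y" using \<alpha> uz Y by simp_all
  then have d: "0 < d" "\<alpha> * u z \<le> d" "(1 - \<alpha>) * Y \<le> d" by (simp_all add: d_def)
  have p: "0 \<le> p" using c \<alpha> uz by (auto simp: p_def)
  have "(\<alpha> * u z) * ((1 - \<alpha>) * Y) \<le> d * d"
    using d au ay by (intro mult_mono) auto
  then have "(\<alpha> * u z) * ((1 - \<alpha>) * Y) / d\<^sup>2 \<le> 1"
    using d(1) by (simp add: power2_eq_square)
  then have "\<alpha> * r \<le> 1" by (simp add: r_def mult_ac)
  then have r: "0 \<le> r" "r \<le> 1 / \<alpha>"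
    using \<alpha> uz Y by (simp_all add: r_def pos_le_divide_eq mult.commute)
  \<comment> \<open>Differentiability is assumed of \<open>ln u\<close> only, so \<open>u\<close> is recovered as its exponential.\<close>
  have "((\<lambda>x. exp (ln (u x))) has_real_derivative u z * l') (at z within T)"
    using DERIV_chain2[OF DERIV_exp l] uz by simp
  then have du: "(u has_real_derivative u z * l') (at z within T)"
    by (rule has_field_derivative_transform_within[OF _ zero_less_one z]) (simp add: u)
  have "((\<lambda>x. \<alpha> * u x + (1 - \<alpha>) * (y + c * x)) has_real_derivative \<alpha> * (u z * l') + (1 - \<alpha>) * c)
      (at z within T)"
    by (auto intro!: derivative_eq_intros du)
  from DERIV_diff[OF DERIV_const DERIV_divide[OF du this]]
  have "((\<lambda>x. weight \<alpha> (u x) (y + c * x)) has_real_derivative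
      0 - (u z * l' * d - u z * (\<alpha> * (u z * l') + (1 - \<alpha>) * c)) / (d * d)) (at z within T)"
    using d(1) unfolding weight_def d_def Y_def by simp
  moreover have "0 - (u z * l' * d - u z * (\<alpha> * (u z * l') + (1 - \<alpha>) * c)) / (d * d) = p - r * l'"
    using d(1) unfolding p_def r_def
    by (simp add: field_simps power2_eq_square) (simp add: d_def algebra_simps)
  ultimately have W: "((\<lambda>x. weight \<alpha> (u x) (y + c * x)) has_real_derivative p - r * l') (at z within T)"
    by (simp only:)
  have q: "\<bar>r * l'\<bar> \<le> 1 / \<alpha> * \<bar>l'\<bar>"
    using mult_right_mono[OF r(2), of "\<bar>l'\<bar>"] r(1) by (simp add: abs_mult)
  have "\<bar>p - x\<bar> \<le> c * (p - x) + 2 * X" if "\<bar>x\<bar> \<le> X" for x X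
    using c
  proof
    assume "c = 0"
    then show ?thesis using that by (simp add: p_def)
  next
    assume "c = 1"
    then show ?thesis using that p by simp
  qed
  from this[OF q] have "\<bar>p - r * l'\<bar> \<le> c * (p - r * l') + 2 / \<alpha> * \<bar>l'\<bar>" by simp
  with W show thesis by (rule that)
qed

section \<open>Curves of bounded length\<close>

text \<open>
  The length is measured by a real function \<open>\<Phi>\<close> growing at least as fast as the curve moves, rather
  than by integrating the speed. The speed of the curves below involves second derivatives that need
  not be continuous at the frequencies \<open>0\<close> and \<open>\<pi>\<close>, so that its integrability is unclear, whereas
  \<open>\<Phi>\<close> can be written down explicitly. Since \<open>\<Phi>\<close> is nondecreasing, \<open>B\<close> bounds its total increase.
\<close>

definition length_le :: "(real \<Rightarrow> 'a::real_normed_vector) \<Rightarrow> real \<Rightarrow> bool" where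
  "length_le \<theta> B \<longleftrightarrow> (\<exists>D \<Phi> \<Phi>'. \<forall>z\<ge>0.
     (\<theta> has_vector_derivative D z) (at z within {0..}) \<and>
     (\<Phi> has_real_derivative \<Phi>' z) (at z within {0..}) \<and>
     norm (D z) \<le> \<Phi>' z \<and> \<Phi> z - \<Phi> 0 \<le> B)"

lemma length_le_imp_dist_le:
  fixes \<theta> :: "real \<Rightarrow> 'a::real_normed_vector"
  assumes "length_le \<theta> B" "0 \<le> z"
  shows "norm (\<theta> z - \<theta> 0) \<le> B"
proof -
  obtain D \<Phi> \<Phi>' where
    \<theta>: "\<And>z. 0 \<le> z \<Longrightarrow> (\<theta> has_vector_derivative D z) (at z within {0..})" and
    \<Phi>: "\<And>z. 0 \<le> z \<Longrightarrow> (\<Phi> has_real_derivative \<Phi>' z) (at z within {0..})" and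
    le: "\<And>z. 0 \<le> z \<Longrightarrow> norm (D z) \<le> \<Phi>' z" and
    B: "\<And>z. 0 \<le> z \<Longrightarrow> \<Phi> z - \<Phi> 0 \<le> B"
    using assms(1) unfolding length_le_def by metis
  have \<Phi>v: "(\<Phi> has_vector_derivative \<Phi>' x) (at x within {0..})" if "0 \<le> x" for x
    using \<Phi>[OF that] by (simp add: has_real_derivative_iff_has_vector_derivative)
  have at: "at x within {0..} = at x" if "0 < x" for x :: real
    using that by (intro at_within_interior) simp
  have 0: "0 \<le> B" using B[of 0] by simp
  show ?thesis
  proof (cases "z = 0")
    case False
    then have "0 < z" using assms(2) by simp
    then have "norm (\<theta> z - \<theta> 0) \<le> \<Phi> z - \<Phi> 0"
    proof (rule differentiable_bound_general)
      show "continuous_on {0..z} \<theta>"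
        by (rule continuous_on_subset[of "{0..}"])
          (auto simp: continuous_on_eq_continuous_within intro: has_vector_derivative_continuous \<theta>)
      show "continuous_on {0..z} \<Phi>"
        by (rule continuous_on_subset[of "{0..}"])
          (auto simp: continuous_on_eq_continuous_within intro: has_vector_derivative_continuous \<Phi>v)
    next
      fix x assume x: "0 < x" "x < z"
      show "(\<theta> has_vector_derivative D x) (at x)" using \<theta>[of x] x at[of x] by simp
      show "(\<Phi> has_vector_derivative \<Phi>' x) (at x)" using \<Phi>v[of x] x at[of x] by simp
      show "norm (D x) \<le> \<Phi>' x" using le x by simp
    qed
    then show ?thesis using B[OF assms(2)] by linarith
  qed (simp add: 0)
qed

section \<open>One gradient step\<close>

lemma contaminate_eq: "contaminate J z \<omega>' \<omega> = J \<omega> + (if \<omega> = \<omega>' \<or> \<omega> = - \<omega>' then 1 else 0) * z"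
  by (simp add: contaminate_def)

lemma contaminate_0: "contaminate J 0 \<omega>' = J"
  by (rule ext) (simp add: contaminate_def)

text \<open>
  Differentiating the updated curve by the product rule gives, besides the old velocity, one term for
  each frequency from the change of the log-gradient, bounded by the operator norm of the Hessian
  times the speed, and one from the change of the weight, bounded by \<open>weight_along_curve\<close>. Summed
  over the at most \<open>n\<close> frequencies and divided by \<open>n\<close>, the parts proportional to the speed give the factor
  \<open>1 + \<gamma> (2 U\<^sup>2 + C) / (1 - \<alpha>)\<close>. What remains is a multiple of the signed derivatives of the (at most two)
  contaminated weights, whose antiderivatives are the weights themselves; their range \<open>1/\<alpha>\<close>
  yields the additive term, of order \<open>1/n\<close>.
\<close>

lemma length_le_descent_step:
  fixes S :: "real ^ 'd \<Rightarrow> real \<Rightarrow> ennreal" and \<theta> :: "real \<Rightarrow> real ^ 'd"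
  assumes \<alpha>: "0 < \<alpha>" "\<alpha> < 1" and \<gamma>: "0 \<le> \<gamma>" and n: "1 \<le> n"
    and V: "\<And>z. 0 \<le> z \<Longrightarrow> \<theta> z \<in> V"
    and J: "\<And>\<omega>. \<omega> \<in> Omega n \<Longrightarrow> 0 \<le> J \<omega>"
    and S: "\<And>\<phi> \<omega>. \<phi> \<in> V \<Longrightarrow> \<omega> \<in> Omega n \<Longrightarrow> 0 < enn2real (S \<phi> \<omega>)"
    and diff: "\<And>\<omega>. \<omega> \<in> Omega n \<Longrightarrow> twice_differentiable_on (\<lambda>\<phi>. ln (enn2real (S \<phi> \<omega>))) V"
    and U: "\<And>\<phi> \<omega>. \<phi> \<in> V \<Longrightarrow> \<omega> \<in> Omega n \<Longrightarrow> norm (grad (\<lambda>\<phi>. ln (enn2real (S \<phi> \<omega>))) \<phi>) \<le> U"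
    and C: "\<And>\<phi>. \<phi> \<in> V \<Longrightarrow>
      (\<Sum>\<omega>\<in>Omega n. op_norm (hessian (\<lambda>\<phi>. ln (enn2real (S \<phi> \<omega>))) \<phi>)) \<le> C * real n"
    and length: "length_le \<theta> B"
  shows "length_le (\<lambda>z. \<theta> z + \<gamma> *\<^sub>R descent_dir \<alpha> n S (contaminate J z \<omega>') (\<theta> z))
    ((1 + \<gamma> * (2 * U\<^sup>2 + C) / (1 - \<alpha>)) * B + \<gamma> * 2 * U / ((1 - \<alpha>) * real n))"
proof -
  obtain D \<Phi> \<Phi>' where
    \<theta>: "\<And>z. 0 \<le> z \<Longrightarrow> (\<theta> has_vector_derivative D z) (at z within {0..})" and
    \<Phi>: "\<And>z. 0 \<le> z \<Longrightarrow> (\<Phi> has_real_derivative \<Phi>' z) (at z within {0..})" and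
    D_le: "\<And>z. 0 \<le> z \<Longrightarrow> norm (D z) \<le> \<Phi>' z" and
    B: "\<And>z. 0 \<le> z \<Longrightarrow> \<Phi> z - \<Phi> 0 \<le> B"
    using length unfolding length_le_def by metis
  define l where "l \<omega> \<phi> = ln (enn2real (S \<phi> \<omega>))" for \<omega> \<phi>
  define c where "c \<omega> = (if \<omega> = \<omega>' \<or> \<omega> = - \<omega>' then 1 else 0 :: real)" for \<omega>
  define W where "W \<omega> z = weight \<alpha> (enn2real (S (\<theta> z) \<omega>)) (J \<omega> + c \<omega> * z)" for \<omega> z
  have lT: "(\<lambda>\<phi>. ln (enn2real (S \<phi> \<omega>))) = l \<omega>" for \<omega> by (auto simp: l_def)
  have c01: "c \<omega> = 0 \<or> c \<omega> = 1" for \<omega> by (simp add: c_def)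
  have Jc: "0 \<le> J \<omega> + c \<omega> * z" if "0 \<le> z" "\<omega> \<in> Omega n" for \<omega> z
    using J[OF that(2)] that(1) c01[of \<omega>] by auto
  have diff1: "l \<omega> differentiable (at \<phi>)" and diff2: "grad (l \<omega>) differentiable (at \<phi>)"
    if "\<phi> \<in> V" "\<omega> \<in> Omega n" for \<phi> \<omega>
    using diff[OF that(2)] that(1) unfolding twice_differentiable_on_def lT by auto
  have U': "norm (grad (l \<omega>) \<phi>) \<le> U" if "\<phi> \<in> V" "\<omega> \<in> Omega n" for \<phi> \<omega>
    using U[OF that] unfolding lT .
  have C': "(\<Sum>\<omega>\<in>Omega n. op_norm (hessian (l \<omega>) \<phi>)) \<le> C * real n" if "\<phi> \<in> V" for \<phi>
    using C[OF that] unfolding lT .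
  have U0: "0 \<le> U"
    using U'[OF V[of 0] zero_in_Omega[OF n]] norm_ge_zero[of "grad (l 0) (\<theta> 0)"] by linarith
  have C0: "0 \<le> C"
  proof -
    have "0 \<le> (\<Sum>\<omega>\<in>Omega n. op_norm (hessian (l \<omega>) (\<theta> 0)))"
      unfolding op_norm_def by (intro sum_nonneg onorm_pos_le) (rule matrix_vector_mul_bounded_linear)
    also have "\<dots> \<le> C * real n" using C'[OF V] by simp
    finally show ?thesis using n by (simp add: zero_le_mult_iff)
  qed
  have lz: "((\<lambda>z. l \<omega> (\<theta> z)) has_real_derivative inner (D z) (grad (l \<omega>) (\<theta> z))) (at z within {0..})"
    if "0 \<le> z" "\<omega> \<in> Omega n" for z \<omega>
  proof -
    have "(l \<omega> has_derivative (\<lambda>h. inner h (grad (l \<omega>) (\<theta> z)))) (at (\<theta> z) within \<theta> ` {0..})"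
      using GDERIV_grad[OF diff1[OF V[OF that(1)] that(2)]] unfolding gderiv_def
      by (rule has_derivative_at_withinI)
    from vector_derivative_diff_chain_within[OF \<theta>[OF that(1)] this]
    show ?thesis by (simp add: o_def has_real_derivative_iff_has_vector_derivative)
  qed
  have gz: "((\<lambda>z. grad (l \<omega>) (\<theta> z)) has_vector_derivative hessian (l \<omega>) (\<theta> z) *v D z) (at z within {0..})"
    if "0 \<le> z" "\<omega> \<in> Omega n" for z \<omega>
  proof -
    have "(grad (l \<omega>) has_derivative (\<lambda>h. hessian (l \<omega>) (\<theta> z) *v h)) (at (\<theta> z) within \<theta> ` {0..})"
      using diff2[OF V[OF that(1)] that(2)] unfolding hessian_def jacobian_works
      by (rule has_derivative_at_withinI)
    from vector_derivative_diff_chain_within[OF \<theta>[OF that(1)] this]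
    show ?thesis by (simp add: o_def)
  qed
  have W'_ex: "\<exists>W'. (W \<omega> has_real_derivative W') (at z within {0..}) \<and>
      \<bar>W'\<bar> \<le> c \<omega> * W' + 2 / \<alpha> * \<bar>inner (D z) (grad (l \<omega>) (\<theta> z))\<bar>"
    if z: "0 \<le> z" and \<omega>: "\<omega> \<in> Omega n" for z \<omega>
  proof -
    have "((\<lambda>z. ln (enn2real (S (\<theta> z) \<omega>))) has_real_derivative inner (D z) (grad (l \<omega>) (\<theta> z)))
        (at z within {0..})"
      using lz[OF z \<omega>] by (simp only: l_def)
    from weight_along_curve[OF \<alpha> _ _ this Jc[OF z \<omega>] c01]
    obtain W' where "((\<lambda>x. weight \<alpha> (enn2real (S (\<theta> x) \<omega>)) (J \<omega> + c \<omega> * x)) has_real_derivative W')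
        (at z within {0..})"
      "\<bar>W'\<bar> \<le> c \<omega> * W' + 2 / \<alpha> * \<bar>inner (D z) (grad (l \<omega>) (\<theta> z))\<bar>"
      using z S[OF V \<omega>] by auto
    then show ?thesis unfolding W_def by blast
  qed
  define W' where "W' \<omega> z = (SOME d. (W \<omega> has_real_derivative d) (at z within {0..}) \<and>
      \<bar>d\<bar> \<le> c \<omega> * d + 2 / \<alpha> * \<bar>inner (D z) (grad (l \<omega>) (\<theta> z))\<bar>)" for \<omega> z
  have Wz: "(W \<omega> has_real_derivative W' \<omega> z) (at z within {0..})"
    and W'_le: "\<bar>W' \<omega> z\<bar> \<le> c \<omega> * W' \<omega> z + 2 / \<alpha> * \<bar>inner (D z) (grad (l \<omega>) (\<theta> z))\<bar>"
    if "0 \<le> z" "\<omega> \<in> Omega n" for \<omega> z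
    using someI_ex[OF W'_ex[OF that]] unfolding W'_def by blast+
  have W_le: "\<bar>W \<omega> z\<bar> \<le> 1 / \<alpha>" "W \<omega> z - W \<omega> 0 \<le> 1 / \<alpha>" if "0 \<le> z" "\<omega> \<in> Omega n" for \<omega> z
    using abs_weight_le[OF \<alpha> S[OF V[OF that(1)] that(2)] Jc[OF that]]
      weight_bounds[OF \<alpha> S[OF V[OF that(1)] that(2)] Jc[OF that]]
      weight_bounds[OF \<alpha> S[OF V[OF order_refl] that(2)] Jc[OF order_refl that(2)]]
    unfolding W_def by linarith+
  define \<beta> where "\<beta> = \<gamma> * (\<alpha> / ((1 - \<alpha>) * real n))"
  have \<beta>: "0 \<le> \<beta>" using \<alpha> \<gamma> by (simp add: \<beta>_def)
  define A where "A = 1 + \<gamma> * (2 * U\<^sup>2 + C) / (1 - \<alpha>)"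
  have \<beta>n: "\<beta> / \<alpha> * real n = \<gamma> / (1 - \<alpha>)"
    using \<alpha> n by (simp add: \<beta>_def)
  have A0: "0 \<le> A" using \<alpha> \<gamma> C0 by (simp add: A_def)
  have eq: "\<theta> z + \<gamma> *\<^sub>R descent_dir \<alpha> n S (contaminate J z \<omega>') (\<theta> z) =
      \<theta> z + \<beta> *\<^sub>R (\<Sum>\<omega>\<in>Omega n. W \<omega> z *\<^sub>R grad (l \<omega>) (\<theta> z))" for z
    unfolding descent_dir_def contaminate_eq lT W_def weight_def c_def \<beta>_def by simp
  define D1 where "D1 z = D z + \<beta> *\<^sub>R (\<Sum>\<omega>\<in>Omega n.
      W \<omega> z *\<^sub>R (hessian (l \<omega>) (\<theta> z) *v D z) + W' \<omega> z *\<^sub>R grad (l \<omega>) (\<theta> z))" for z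
  \<comment> \<open>The coefficient \<open>c \<omega>\<close> selects the contaminated frequencies; the weights at the others
    contribute to the speed only through the motion of the iterate, which the factor \<open>A\<close> absorbs.\<close>
  define \<Phi>1 where "\<Phi>1 z = A * \<Phi> z + \<beta> * U * (\<Sum>\<omega>\<in>Omega n. c \<omega> * W \<omega> z)" for z
  define \<Phi>1' where "\<Phi>1' z = A * \<Phi>' z + \<beta> * U * (\<Sum>\<omega>\<in>Omega n. c \<omega> * W' \<omega> z)" for z
  have 1: "((\<lambda>z. \<theta> z + \<beta> *\<^sub>R (\<Sum>\<omega>\<in>Omega n. W \<omega> z *\<^sub>R grad (l \<omega>) (\<theta> z))) has_vector_derivative D1 z)
      (at z within {0..})" if z: "0 \<le> z" for z
    unfolding D1_def
    by (intro has_vector_derivative_add \<theta> z has_vector_derivative_sum has_vector_derivative_scaleR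
        bounded_linear.has_vector_derivative[OF bounded_linear_scaleR_right] Wz gz)
  have 2: "(\<Phi>1 has_real_derivative \<Phi>1' z) (at z within {0..})" if z: "0 \<le> z" for z
    unfolding \<Phi>1_def[abs_def] \<Phi>1'_def
    by (intro DERIV_add DERIV_cmult DERIV_sum \<Phi> Wz z)
  have 3: "norm (D1 z) \<le> \<Phi>1' z" if z: "0 \<le> z" for z
  proof -
    let ?h = "\<lambda>\<omega>. op_norm (hessian (l \<omega>) (\<theta> z))"
    let ?d = "norm (D z)"
    have "norm (W \<omega> z *\<^sub>R (hessian (l \<omega>) (\<theta> z) *v D z) + W' \<omega> z *\<^sub>R grad (l \<omega>) (\<theta> z))
        \<le> ?d / \<alpha> * ?h \<omega> + (U * (c \<omega> * W' \<omega> z) + 2 * U\<^sup>2 / \<alpha> * ?d)"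
      if \<omega>: "\<omega> \<in> Omega n" for \<omega>
    proof -
      have g: "norm (grad (l \<omega>) (\<theta> z)) \<le> U" by (rule U'[OF V[OF z] \<omega>])
      have "norm (hessian (l \<omega>) (\<theta> z) *v D z) \<le> ?h \<omega> * ?d"
        unfolding op_norm_def by (rule onorm) (rule matrix_vector_mul_bounded_linear)
      then have "\<bar>W \<omega> z\<bar> * norm (hessian (l \<omega>) (\<theta> z) *v D z) \<le> 1 / \<alpha> * (?h \<omega> * ?d)"
        using W_le(1)[OF z \<omega>] \<alpha> by (intro mult_mono) auto
      moreover have "\<bar>inner (D z) (grad (l \<omega>) (\<theta> z))\<bar> \<le> ?d * U"
        using Cauchy_Schwarz_ineq2[of "D z" "grad (l \<omega>) (\<theta> z)"] mult_left_mono[OF g, of ?d] by simp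
      then have "2 / \<alpha> * \<bar>inner (D z) (grad (l \<omega>) (\<theta> z))\<bar> \<le> 2 / \<alpha> * (?d * U)"
        using \<alpha> by (intro mult_left_mono) auto
      then have "\<bar>W' \<omega> z\<bar> \<le> c \<omega> * W' \<omega> z + 2 / \<alpha> * (?d * U)"
        using W'_le[OF z \<omega>] by linarith
      then have "\<bar>W' \<omega> z\<bar> * norm (grad (l \<omega>) (\<theta> z)) \<le> (c \<omega> * W' \<omega> z + 2 / \<alpha> * (?d * U)) * U"
        using g by (intro mult_mono) auto
      ultimately show ?thesis
        by (intro norm_triangle_le) (simp add: algebra_simps power2_eq_square)
    qed
    then have "norm (\<Sum>\<omega>\<in>Omega n. W \<omega> z *\<^sub>R (hessian (l \<omega>) (\<theta> z) *v D z) + W' \<omega> z *\<^sub>R grad (l \<omega>) (\<theta> z))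
        \<le> (\<Sum>\<omega>\<in>Omega n. ?d / \<alpha> * ?h \<omega> + (U * (c \<omega> * W' \<omega> z) + 2 * U\<^sup>2 / \<alpha> * ?d))"
      by (rule sum_norm_le)
    also have "\<dots> = ?d / \<alpha> * (\<Sum>\<omega>\<in>Omega n. ?h \<omega>)
        + (U * (\<Sum>\<omega>\<in>Omega n. c \<omega> * W' \<omega> z) + real (card (Omega n)) * (2 * U\<^sup>2 / \<alpha> * ?d))"
      by (simp add: sum.distrib sum_distrib_left)
    also have "\<dots> \<le> ?d / \<alpha> * (C * real n)
        + (U * (\<Sum>\<omega>\<in>Omega n. c \<omega> * W' \<omega> z) + real n * (2 * U\<^sup>2 / \<alpha> * ?d))"
      using C'[OF V[OF z]] card_Omega_le[of n] \<alpha>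
      by (intro add_mono mult_left_mono mult_right_mono order_refl) auto
    finally have "norm (D1 z) \<le> ?d + \<beta> * (?d / \<alpha> * (C * real n)
        + (U * (\<Sum>\<omega>\<in>Omega n. c \<omega> * W' \<omega> z) + real n * (2 * U\<^sup>2 / \<alpha> * ?d)))"
      unfolding D1_def using \<beta> by (intro norm_triangle_le add_mono) (auto intro!: mult_left_mono)
    also have "\<dots> = ?d + (\<beta> / \<alpha> * real n) * (2 * U\<^sup>2 + C) * ?d + \<beta> * U * (\<Sum>\<omega>\<in>Omega n. c \<omega> * W' \<omega> z)"
      by (simp add: algebra_simps)
    also have "\<dots> = A * ?d + \<beta> * U * (\<Sum>\<omega>\<in>Omega n. c \<omega> * W' \<omega> z)"
      unfolding \<beta>n A_def by (simp add: algebra_simps add_divide_distrib)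
    also have "\<dots> \<le> \<Phi>1' z"
      unfolding \<Phi>1'_def using D_le[OF z] A0 by (intro add_right_mono mult_left_mono)
    finally show ?thesis .
  qed
  have 4: "\<Phi>1 z - \<Phi>1 0 \<le> A * B + \<gamma> * 2 * U / ((1 - \<alpha>) * real n)" if z: "0 \<le> z" for z
  proof -
    have "(\<Sum>\<omega>\<in>Omega n. c \<omega> * W \<omega> z) - (\<Sum>\<omega>\<in>Omega n. c \<omega> * W \<omega> 0)
        = (\<Sum>\<omega>\<in>Omega n. c \<omega> * (W \<omega> z - W \<omega> 0))"
      by (simp add: sum_subtractf algebra_simps)
    also have "\<dots> = (\<Sum>\<omega>\<in>Omega n \<inter> {\<omega>', - \<omega>'}. W \<omega> z - W \<omega> 0)"
      using finite_Omega by (intro sum.mono_neutral_cong_right) (auto simp: c_def)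
    also have "\<dots> \<le> real (card (Omega n \<inter> {\<omega>', - \<omega>'})) * (1 / \<alpha>)"
      using W_le(2)[OF z] by (intro sum_bounded_above) auto
    also have "\<dots> \<le> real 2 * (1 / \<alpha>)"
    proof -
      have "card (Omega n \<inter> {\<omega>', - \<omega>'}) \<le> card {\<omega>', - \<omega>'}" by (rule card_mono) auto
      also have "\<dots> \<le> 2" by (simp add: card_insert_if)
      finally show ?thesis using \<alpha> by (intro mult_right_mono) auto
    qed
    finally have "\<beta> * U * ((\<Sum>\<omega>\<in>Omega n. c \<omega> * W \<omega> z) - (\<Sum>\<omega>\<in>Omega n. c \<omega> * W \<omega> 0))
        \<le> \<beta> * U * (2 * (1 / \<alpha>))"
      using \<beta> U0 by (intro mult_left_mono) auto
    moreover have "\<beta> * U * (2 * (1 / \<alpha>)) = \<gamma> * 2 * U / ((1 - \<alpha>) * real n)"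
      using \<alpha> by (simp add: \<beta>_def)
    moreover have "A * (\<Phi> z - \<Phi> 0) \<le> A * B" using B[OF z] A0 by (rule mult_left_mono)
    ultimately show ?thesis unfolding \<Phi>1_def by (simp add: algebra_simps)
  qed
  show ?thesis
    unfolding eq length_le_def A_def[symmetric] using 1 2 3 4 by blast
qed

text \<open>
  The recursion of \<open>length_le_descent_step\<close> with the factor \<open>1/n\<close> taken out. That nothing
  else in it depends on \<open>n\<close> is what makes the lengths vanish in the limit.
\<close>

primrec length_const :: "real \<Rightarrow> (nat \<Rightarrow> real) \<Rightarrow> real \<Rightarrow> real \<Rightarrow> nat \<Rightarrow> real" where
  "length_const \<alpha> \<gamma> U C 0 = 0"
| "length_const \<alpha> \<gamma> U C (Suc m) =
    (1 + \<gamma> (Suc m) * (2 * U\<^sup>2 + C) / (1 - \<alpha>)) * length_const \<alpha> \<gamma> U C m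
      + \<gamma> (Suc m) * 2 * U / (1 - \<alpha>)"

lemma length_le_gd_update:
  fixes S :: "real ^ 'd \<Rightarrow> real \<Rightarrow> ennreal"
  assumes \<alpha>: "0 < \<alpha>" "\<alpha> < 1" and \<gamma>: "\<And>k. 1 \<le> k \<Longrightarrow> 0 < \<gamma> k" and n: "1 \<le> n"
    and V: "\<And>z k. 0 \<le> z \<Longrightarrow> gd_update \<alpha> n S \<gamma> \<theta>0 (contaminate J z \<omega>') k \<in> V"
    and J: "\<And>\<omega>. \<omega> \<in> Omega n \<Longrightarrow> 0 \<le> J \<omega>"
    and S: "\<And>\<phi> \<omega>. \<phi> \<in> V \<Longrightarrow> \<omega> \<in> Omega n \<Longrightarrow> 0 < enn2real (S \<phi> \<omega>)"
    and diff: "\<And>\<omega>. \<omega> \<in> Omega n \<Longrightarrow> twice_differentiable_on (\<lambda>\<phi>. ln (enn2real (S \<phi> \<omega>))) V"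
    and U: "\<And>\<phi> \<omega>. \<phi> \<in> V \<Longrightarrow> \<omega> \<in> Omega n \<Longrightarrow> norm (grad (\<lambda>\<phi>. ln (enn2real (S \<phi> \<omega>))) \<phi>) \<le> U"
    and C: "\<And>\<phi>. \<phi> \<in> V \<Longrightarrow>
      (\<Sum>\<omega>\<in>Omega n. op_norm (hessian (\<lambda>\<phi>. ln (enn2real (S \<phi> \<omega>))) \<phi>)) \<le> C * real n"
  shows "length_le (\<lambda>z. gd_update \<alpha> n S \<gamma> \<theta>0 (contaminate J z \<omega>') m)
    (length_const \<alpha> \<gamma> U C m / real n)"
proof (induction m)
  case 0
  show ?case
    unfolding length_le_def
    by (intro exI[of _ "\<lambda>_. 0"]) auto
next
  case (Suc m)
  have \<gamma>0: "0 \<le> \<gamma> (Suc m)" using \<gamma>[of "Suc m"] by simp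
  have eq: "length_const \<alpha> \<gamma> U C (Suc m) / real n =
      (1 + \<gamma> (Suc m) * (2 * U\<^sup>2 + C) / (1 - \<alpha>)) * (length_const \<alpha> \<gamma> U C m / real n)
      + \<gamma> (Suc m) * 2 * U / ((1 - \<alpha>) * real n)"
    by (simp add: add_divide_distrib)
  show ?case
    unfolding gd_update.simps eq
    by (rule length_le_descent_step[OF \<alpha> \<gamma>0 n V J S diff U C Suc.IH])
qed

section \<open>Uniform robustness to contamination\<close>

theorem theorem3:
  fixes \<Theta> :: "(real ^ 'd) set"
    and S :: "real ^ 'd \<Rightarrow> real \<Rightarrow> ennreal"
    and M :: "'w measure"
    and X :: "nat \<Rightarrow> 'w \<Rightarrow> real"
    and pilot :: "nat \<Rightarrow> (nat \<Rightarrow> real) \<Rightarrow> real \<Rightarrow> real"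
    and \<gamma> :: "nat \<Rightarrow> real"
    and \<theta>0 :: "real ^ 'd"
    and \<alpha> :: real
    and m :: nat
  assumes "compact \<Theta>" and "interior \<Theta> \<noteq> {}"
    and "\<And>\<theta>. \<theta> \<in> \<Theta> \<Longrightarrow> S \<theta> \<in> spectral_class"
    and "prob_space M"
    and "\<And>t. X t \<in> borel_measurable M"
    and "\<And>n \<omega>. 1 \<le> n \<Longrightarrow> \<omega> \<in> {-pi..pi} \<Longrightarrow>
      (\<lambda>x. pilot n x \<omega>) \<in> borel_measurable (PiM {1..n} (\<lambda>_. borel))"
    and "\<And>n \<omega> w. 1 \<le> n \<Longrightarrow> \<omega> \<in> {-pi..pi} \<Longrightarrow> w \<in> space M \<Longrightarrow>
      0 \<le> pilot n (observed X n w) \<omega>"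
    and "0 < \<alpha>" and "\<alpha> < 1"
    and "\<And>k. 1 \<le> k \<Longrightarrow> 0 < \<gamma> k"
    and "\<And>\<omega>. \<omega> \<in> {0<..<pi} \<Longrightarrow>
      twice_continuously_differentiable_on (\<lambda>\<theta>. enn2real (S \<theta> \<omega>)) (interior \<Theta>)"
    \<comment> \<open>well-definedness of the gradients and Hessians occurring below\<close>
    and "\<And>\<theta> \<omega>. \<theta> \<in> interior \<Theta> \<Longrightarrow> \<omega> \<in> {-pi..pi} \<Longrightarrow>
      0 < S \<theta> \<omega> \<and> S \<theta> \<omega> < \<infinity> \<and> (\<lambda>\<phi>. enn2real (S \<phi> \<omega>)) differentiable (at \<theta>)"
    and "\<And>n \<omega>. 1 \<le> n \<Longrightarrow> \<omega> \<in> Omega n \<Longrightarrow>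
      twice_differentiable_on (\<lambda>\<theta>. ln (enn2real (S \<theta> \<omega>))) (interior \<Theta>)"
    and "(SUP (\<theta>, \<omega>) \<in> interior \<Theta> \<times> {-pi..pi}.
        ereal (Max {norm (grad (\<lambda>\<phi>. enn2real (S \<phi> \<omega>)) \<theta>),
                    norm (grad (\<lambda>\<phi>. ln (enn2real (S \<phi> \<omega>))) \<theta>),
                    norm ((1 / enn2real (S \<theta> \<omega>)) *\<^sub>R grad (\<lambda>\<phi>. ln (enn2real (S \<phi> \<omega>))) \<theta>)})) < \<infinity>"
    and "limsup (\<lambda>n. SUP \<theta> \<in> interior \<Theta>.
        ereal (1 / real n * (\<Sum>\<omega>\<in>Omega n. op_norm (hessian (\<lambda>\<phi>. ln (enn2real (S \<phi> \<omega>))) \<theta>)))) < \<infinity>"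
    and "AE w in M. \<forall>n\<ge>1. \<forall>z\<ge>0. \<forall>\<omega>'\<in>Omega n. \<forall>k.
        gd_update \<alpha> n S \<gamma> \<theta>0 (contaminate (pilot n (observed X n w)) z \<omega>') k \<in> interior \<Theta>"
  shows "AE w in M. (\<lambda>n. SUP (z, \<omega>') \<in> {0..} \<times> Omega n.
        ereal (norm (gd_update \<alpha> n S \<gamma> \<theta>0 (contaminate (pilot n (observed X n w)) z \<omega>') m
                   - gd_update \<alpha> n S \<gamma> \<theta>0 (pilot n (observed X n w)) m))) \<longlonglongrightarrow> 0"
proof -
  note \<alpha> = assms(8,9) and \<gamma> = assms(10) and S_regular = assms(12) and twice_diff = assms(13)
    and gradient_sup = assms(14) and hessian_limsup = assms(15) and updates_inside = assms(16)
  let ?V = "interior \<Theta>"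
  let ?l = "\<lambda>\<omega> \<phi>. ln (enn2real (S \<phi> \<omega>))"
  obtain U where U: "\<And>\<phi> \<omega>. \<phi> \<in> ?V \<Longrightarrow> \<omega> \<in> {-pi..pi} \<Longrightarrow> norm (grad (?l \<omega>) \<phi>) \<le> U"
  proof -
    obtain U :: real where "(SUP (\<theta>, \<omega>) \<in> ?V \<times> {-pi..pi}.
        ereal (Max {norm (grad (\<lambda>\<phi>. enn2real (S \<phi> \<omega>)) \<theta>),
                    norm (grad (\<lambda>\<phi>. ln (enn2real (S \<phi> \<omega>))) \<theta>),
                    norm ((1 / enn2real (S \<theta> \<omega>)) *\<^sub>R grad (\<lambda>\<phi>. ln (enn2real (S \<phi> \<omega>))) \<theta>)})) < ereal U"
      using ereal_dense2[OF gradient_sup] by blast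
    note sup = less_imp_le[OF this, unfolded SUP_le_iff]
    show thesis
    proof (rule that[of U])
      fix \<phi> \<omega> assume *: "\<phi> \<in> ?V" "\<omega> \<in> {-pi..pi::real}"
      show "norm (grad (?l \<omega>) \<phi>) \<le> U"
        using bspec[OF sup, of "(\<phi>, \<omega>)"] * by simp
    qed
  qed
  obtain C N where C: "\<And>n \<phi>. N \<le> n \<Longrightarrow> 1 \<le> n \<Longrightarrow> \<phi> \<in> ?V \<Longrightarrow>
      (\<Sum>\<omega>\<in>Omega n. op_norm (hessian (?l \<omega>) \<phi>)) \<le> C * real n"
  proof -
    obtain C :: real where "limsup (\<lambda>n. SUP \<theta> \<in> ?V.
        ereal (1 / real n * (\<Sum>\<omega>\<in>Omega n. op_norm (hessian (?l \<omega>) \<theta>)))) < ereal C"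
      using ereal_dense2[OF hessian_limsup] by blast
    then have "eventually (\<lambda>n. (SUP \<theta> \<in> ?V.
        ereal (1 / real n * (\<Sum>\<omega>\<in>Omega n. op_norm (hessian (?l \<omega>) \<theta>)))) < ereal C) sequentially"
      by (rule Limsup_lessD)
    then obtain N where N: "\<And>n. N \<le> n \<Longrightarrow> (SUP \<theta> \<in> ?V.
        ereal (1 / real n * (\<Sum>\<omega>\<in>Omega n. op_norm (hessian (?l \<omega>) \<theta>)))) < ereal C"
      unfolding eventually_sequentially by blast
    show thesis
    proof (rule that[of N C])
      fix n \<phi> assume *: "N \<le> n" "1 \<le> n" "\<phi> \<in> ?V"
      have "ereal (1 / real n * (\<Sum>\<omega>\<in>Omega n. op_norm (hessian (?l \<omega>) \<phi>))) \<le> ereal C"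
        using less_imp_le[OF N[OF *(1)], unfolded SUP_le_iff] *(3) by blast
      then show "(\<Sum>\<omega>\<in>Omega n. op_norm (hessian (?l \<omega>) \<phi>)) \<le> C * real n"
        using *(2) by (simp add: field_simps)
    qed
  qed
  have pos: "0 < enn2real (S \<phi> \<omega>)" if "\<phi> \<in> ?V" "\<omega> \<in> Omega n" for \<phi> \<omega> n
    using S_regular[OF that(1), of \<omega>] that(2) Omega_subset[of n] by (auto simp: enn2real_positive_iff)
  let ?K = "length_const \<alpha> \<gamma> U C m"
  show ?thesis
    using updates_inside AE_space
  proof eventually_elim
    case (elim w)
    let ?J = "\<lambda>n. pilot n (observed X n w)"
    let ?g = "\<lambda>n z \<omega>'. gd_update \<alpha> n S \<gamma> \<theta>0 (contaminate (?J n) z \<omega>') m"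
    let ?e = "\<lambda>n. SUP (z, \<omega>') \<in> {0..} \<times> Omega n. ereal (norm (?g n z \<omega>' - gd_update \<alpha> n S \<gamma> \<theta>0 (?J n) m))"
    \<comment> \<open>The curve of iterates starts at the uncontaminated one, so its length bounds their distance.\<close>
    have bound: "norm (?g n z \<omega>' - gd_update \<alpha> n S \<gamma> \<theta>0 (?J n) m) \<le> ?K / real n"
      if n: "N \<le> n" "1 \<le> n" and z: "0 \<le> z" and \<omega>': "\<omega>' \<in> Omega n" for n z \<omega>'
    proof -
      have "length_le (\<lambda>z. ?g n z \<omega>') (?K / real n)"
      proof (rule length_le_gd_update[OF \<alpha> \<gamma> n(2)])
        fix \<omega> assume \<omega>: "\<omega> \<in> Omega n"
        then have "\<omega> \<in> {-pi..pi}" using Omega_subset by blast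
        then show "0 \<le> ?J n \<omega>" by (rule assms(7)[OF n(2) _ elim(2)])
        show "twice_differentiable_on (?l \<omega>) ?V" by (rule twice_diff[OF n(2) \<omega>])
      next
        fix \<phi> \<omega> assume "\<phi> \<in> ?V" "\<omega> \<in> Omega n"
        then show "0 < enn2real (S \<phi> \<omega>)" "norm (grad (?l \<omega>) \<phi>) \<le> U"
          using pos U Omega_subset by blast+
      next
        fix \<phi> assume "\<phi> \<in> ?V"
        then show "(\<Sum>\<omega>\<in>Omega n. op_norm (hessian (?l \<omega>) \<phi>)) \<le> C * real n" by (rule C[OF n])
      next
        fix z :: real and k assume "0 \<le> z"
        then show "gd_update \<alpha> n S \<gamma> \<theta>0 (contaminate (?J n) z \<omega>') k \<in> ?V"
          using elim(1) n(2) \<omega>' by blast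
      qed
      from length_le_imp_dist_le[OF this z] show ?thesis by (simp add: contaminate_0)
    qed
    have "(\<lambda>n. ereal (?K / real n)) \<longlonglongrightarrow> ereal 0"
      by (intro tendsto_ereal lim_const_over_n)
    then have lim: "(\<lambda>n. ereal (?K / real n)) \<longlonglongrightarrow> 0" by (simp add: zero_ereal_def)
    show ?case
    proof (rule tendsto_sandwich[OF _ _ tendsto_const lim])
      \<comment> \<open>For \<open>n = 0\<close> the supremum is over the empty set, hence \<open>-\<infinity>\<close>.\<close>
      show "eventually (\<lambda>n. 0 \<le> ?e n) sequentially"
        using eventually_ge_at_top[of 1]
      proof eventually_elim
        case (elim n)
        then show ?case
          by (intro SUP_upper2[of "(0, 0)"]) (auto simp: zero_in_Omega)
      qed
      show "eventually (\<lambda>n. ?e n \<le> ereal (?K / real n)) sequentially"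
        using eventually_ge_at_top[of "max N 1"]
      proof eventually_elim
        case (elim n)
        then show ?case
          by (intro SUP_least) (auto intro!: bound)
      qed
    qed
  qed
qed

end
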